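(* Let $n\ge1$ and let $P=(p_{ij})\in\{0,1\}^{n\times n}$ be nonsingular such that the simplex $\mathrm{conv}\{0,p_1,\dots,p_n\}$ (with $p_1,\dots,p_n$ the columns of $P$) is nonobtuse. Write $Q=(q_{ij})=P^{-\top}$. Then for all $i,j$, \[ p_{ij}=1 \implies q_{ij}\ge 0 \quad\text{and}\quad p_{ij}=0\implies q_{ij}\le 0 .\] Moreover, defining the nonnegative matrices $C=\tfrac12(|Q|-Q)$ and $D=\tfrac12(|Q|+Q)$, where $|Q|$ is the matrix of entrywise absolute values of $Q$, we have $Q=D-C$, where $D$ is doubly stochastic and $C$ is row-substochastic.
   Context: The dihedral angle between two facets of an $n$-simplex is $\pi$ minus the angle between their inward normals; a simplex is nonobtuse if none of its dihedral angles exceeds $\pi/2$. A nonnegative matrix is doubly stochastic if all its row and column sums equal $1$, and row-substochastic if all its row sums are at most $1$. *)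

theory Defs
  imports "HOL-Analysis.Analysis"
begin

definition vector_angle :: "'a::real_inner \<Rightarrow> 'a \<Rightarrow> real" where
  "vector_angle u v = arccos ((u \<bullet> v) / (norm u * norm v))"

definition is_inward_unit_normal :: "'a::euclidean_space set \<Rightarrow> 'a set \<Rightarrow> 'a \<Rightarrow> bool" where
  "is_inward_unit_normal S F u \<longleftrightarrow>
     norm u = 1 \<and> (\<exists>b. S \<subseteq> {x. u \<bullet> x \<ge> b} \<and> F = S \<inter> {x. u \<bullet> x = b})"

(* Meaningful for a full-dimensional polyhedron S and a facet F of S; see the lemma
   ex1_inward_unit_normal below. *)
definition inward_unit_normal :: "'a::euclidean_space set \<Rightarrow> 'a set \<Rightarrow> 'a" where
  "inward_unit_normal S F = (THE u. is_inward_unit_normal S F u)"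

lemma inward_unit_normal_unique:
  fixes S :: "'a::euclidean_space set"
  assumes dim: "aff_dim S = int DIM('a)" and F: "F facet_of S"
    and u: "is_inward_unit_normal S F u" and v: "is_inward_unit_normal S F v"
  shows "u = v"
proof -
  obtain b where nu: "norm u = 1" and Su: "S \<subseteq> {x. u \<bullet> x \<ge> b}" and Fu: "F = S \<inter> {x. u \<bullet> x = b}"
    using u unfolding is_inward_unit_normal_def by blast
  obtain c where nv: "norm v = 1" and Sv: "S \<subseteq> {x. v \<bullet> x \<ge> c}" and Fv: "F = S \<inter> {x. v \<bullet> x = c}"
    using v unfolding is_inward_unit_normal_def by blast
  have uu: "u \<bullet> u = 1" and vv: "v \<bullet> v = 1"
    using nu nv by (simp_all add: norm_eq_1)
  have dimF: "aff_dim F = int DIM('a) - 1" and "F \<noteq> {}"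
    using F dim by (auto simp: facet_of_def)
  then obtain x0 where x0: "x0 \<in> F" by blast
  have hull: "affine hull F = {x. w \<bullet> x = d}" if "norm w = 1" "F \<subseteq> {x. w \<bullet> x = d}" for w d
  proof (rule affine_dim_equal)
    show "affine hull F \<subseteq> {x. w \<bullet> x = d}"
      using that(2) by (simp add: affine_hyperplane hull_minimal)
    show "aff_dim (affine hull F) = aff_dim {x. w \<bullet> x = d}"
      using that(1) dimF by (subst aff_dim_hyperplane) (auto simp: of_nat_diff)
  qed (use \<open>F \<noteq> {}\<close> in \<open>auto simp: affine_hyperplane\<close>)
  have eq: "{x. u \<bullet> x = b} = {x. v \<bullet> x = c}"
    using hull[of u b] hull[of v c] nu nv Fu Fv by auto
  define w where "w = v - (u \<bullet> v) *\<^sub>R u"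
  have "u \<bullet> w = 0"
    using uu by (simp add: w_def inner_diff_right)
  then have "x0 + w \<in> {x. u \<bullet> x = b}"
    using x0 Fu by (auto simp: inner_add_right)
  then have "v \<bullet> w = 0"
    using eq x0 Fv by (auto simp: inner_add_right)
  then have "w \<bullet> w = 0"
    using \<open>u \<bullet> w = 0\<close> by (simp add: w_def inner_diff_left)
  then have vu: "v = (u \<bullet> v) *\<^sub>R u"
    by (simp add: w_def)
  then have "\<bar>u \<bullet> v\<bar> = 1"
    using nu nv by (metis mult_1_right norm_scaleR)
  then consider "v = u" | "v = - u"
    using vu by (metis abs_if minus_equation_iff scaleR_minus1_left scaleR_one)
  then show ?thesis
  proof cases
    case 2
    have "c = - b"
      using x0 Fu Fv 2 by auto
    then have "F = S"
      using Su Sv Fu 2 by force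
    then show ?thesis
      using F by simp
  qed simp
qed

lemma ex1_inward_unit_normal:
  fixes S :: "'a::euclidean_space set"
  assumes S: "polyhedron S" and dim: "aff_dim S = int DIM('a)" and F: "F facet_of S"
  shows "\<exists>!u. is_inward_unit_normal S F u"
proof -
  have "F exposed_face_of S"
    using S F exposed_face_of_polyhedron facet_of_imp_face_of by blast
  then obtain a b where ab: "S \<subseteq> {x. a \<bullet> x \<le> b}" "F = S \<inter> {x. a \<bullet> x = b}"
    unfolding exposed_face_of_def by blast
  have "a \<noteq> 0"
    using ab F by (auto simp: facet_of_def)
  have "is_inward_unit_normal S F (- a /\<^sub>R norm a)"
    unfolding is_inward_unit_normal_def
  proof (intro conjI exI[of _ "- b / norm a"])
    show "S \<subseteq> {x. - b / norm a \<le> (- a /\<^sub>R norm a) \<bullet> x}"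
      using ab(1) \<open>a \<noteq> 0\<close> by (auto simp: field_simps)
    show "F = S \<inter> {x. (- a /\<^sub>R norm a) \<bullet> x = - b / norm a}"
      using ab(2) \<open>a \<noteq> 0\<close> by (auto simp: field_simps)
  qed (use \<open>a \<noteq> 0\<close> in simp)
  then show ?thesis
    using inward_unit_normal_unique[OF dim F] by blast
qed

definition dihedral_angle :: "'a::euclidean_space set \<Rightarrow> 'a set \<Rightarrow> 'a set \<Rightarrow> real" where
  "dihedral_angle S F G = pi - vector_angle (inward_unit_normal S F) (inward_unit_normal S G)"

definition nonobtuse :: "'a::euclidean_space set \<Rightarrow> bool" where
  "nonobtuse S \<longleftrightarrow>
     (\<forall>F G. F facet_of S \<and> G facet_of S \<and> F \<noteq> G \<longrightarrow> dihedral_angle S F G \<le> pi / 2)"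

definition nonneg_matrix :: "real^'n^'m \<Rightarrow> bool" where
  "nonneg_matrix A \<longleftrightarrow> (\<forall>i j. A $ i $ j \<ge> 0)"

definition doubly_stochastic :: "real^'n^'n \<Rightarrow> bool" where
  "doubly_stochastic A \<longleftrightarrow>
     nonneg_matrix A \<and> (\<forall>i. (\<Sum>j\<in>UNIV. A $ i $ j) = 1) \<and> (\<forall>j. (\<Sum>i\<in>UNIV. A $ i $ j) = 1)"

definition row_substochastic :: "real^'n^'m \<Rightarrow> bool" where
  "row_substochastic A \<longleftrightarrow> nonneg_matrix A \<and> (\<forall>i. (\<Sum>j\<in>UNIV. A $ i $ j) \<le> 1)"

(* The library's absolute value on vectors, and hence on matrices, is entrywise. *)
lemma abs_matrix_nth: "\<bar>A\<bar> $ i $ j = \<bar>A $ i $ j\<bar>" for A :: "real^'n^'m"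
  by (simp add: abs_vec_def)

end

theory Submission
  imports Defs
begin

text \<open>The columns \<open>q\<^sub>j\<close> of \<open>Q\<close> are dual to the columns of \<open>P\<close>, so they are inward normals of the facets
  through \<open>0\<close>, and \<open>- \<Sum>\<^sub>j q\<^sub>j\<close> is an inward normal of the facet opposite to \<open>0\<close>. Nonobtuseness
  says that the Gram matrix \<open>G = Q\<^sup>T Q\<close> has nonpositive off-diagonal entries and nonnegative row sums.
  Since \<open>Q = P G\<close>, each \<open>q\<^sub>i\<^sub>j\<close> is the sum of the \<open>G\<^sub>k\<^sub>j\<close> over the \<open>k\<close> with \<open>p\<^sub>i\<^sub>k = 1\<close>, which yields the
  sign pattern and nonnegative row sums of \<open>Q\<close>. Therefore \<open>d\<^sub>i\<^sub>j = p\<^sub>i\<^sub>j q\<^sub>i\<^sub>j\<close>, and the row and column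
  sums of \<open>D\<close> are the diagonal entries of \<open>P Q\<^sup>T\<close> and \<open>P\<^sup>T Q\<close>.\<close>

text \<open>A point of the hull is \<open>s *\<^sub>R u + t *\<^sub>R y\<close> with
  \<open>y\<close> in the opposite face, and there \<open>a \<bullet> x - b\<close> equals
  \<open>s * (a \<bullet> u - b)\<close>, which vanishes only for \<open>s = 0\<close>.\<close>

lemma convex_hull_supporting_hyperplane_opposite:
  fixes a :: "'a::euclidean_space"
  assumes "u \<in> V" and "V - {u} \<noteq> {}"
    and eq: "\<And>w. w \<in> V - {u} \<Longrightarrow> a \<bullet> w = b" and gt: "a \<bullet> u > b"
  shows "convex hull V \<subseteq> {x. a \<bullet> x \<ge> b}"
    and "convex hull (V - {u}) = convex hull V \<inter> {x. a \<bullet> x = b}"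
proof -
  have hull: "convex hull (V - {u}) \<subseteq> {x. a \<bullet> x = b}"
    using eq by (intro hull_minimal) (auto simp: convex_hyperplane)
  show "convex hull V \<subseteq> {x. a \<bullet> x \<ge> b}"
    using eq gt by (intro hull_minimal) (force simp: convex_halfspace_ge)+
  show "convex hull (V - {u}) = convex hull V \<inter> {x. a \<bullet> x = b}"
  proof
    show "convex hull (V - {u}) \<subseteq> convex hull V \<inter> {x. a \<bullet> x = b}"
      using hull hull_mono[of "V - {u}" V] by blast
    show "convex hull V \<inter> {x. a \<bullet> x = b} \<subseteq> convex hull (V - {u})"
    proof
      fix x assume x: "x \<in> convex hull V \<inter> {x. a \<bullet> x = b}"
      then have "x \<in> convex hull (insert u (V - {u}))"
        using \<open>u \<in> V\<close> by (simp add: insert_absorb)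
      then obtain s t y where st: "s + t = 1" and y: "y \<in> convex hull (V - {u})"
        and xe: "x = s *\<^sub>R u + t *\<^sub>R y"
        using convex_hull_insert[OF \<open>V - {u} \<noteq> {}\<close>, of u] by blast
      have "s * (a \<bullet> u) + t * b = b"
        using x xe y hull by (auto simp: inner_add_right)
      moreover have "t = 1 - s"
        using st by simp
      ultimately have "s * (a \<bullet> u - b) = 0"
        by (simp add: algebra_simps)
      then have "s = 0"
        using gt by simp
      then show "x \<in> convex hull (V - {u})"
        using xe st y by simp
    qed
  qed
qed

text \<open>Makes the definite description \<open>inward_unit_normal\<close> computable: uniqueness
  holds because \<open>card\<close> forces the simplex to be full-dimensional.\<close>

lemma inward_unit_normal_simplex:
  fixes a :: "'a::euclidean_space"
  assumes indep: "\<not> affine_dependent V" and card: "card V = DIM('a) + 1" and u: "u \<in> V"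
    and eq: "\<And>w. w \<in> V - {u} \<Longrightarrow> a \<bullet> w = b" and gt: "a \<bullet> u > b"
  shows "convex hull (V - {u}) facet_of convex hull V"
    and "inward_unit_normal (convex hull V) (convex hull (V - {u})) = a /\<^sub>R norm a"
    and "a \<noteq> 0"
proof -
  let ?S = "convex hull V" and ?F = "convex hull (V - {u})"
  have card2: "2 \<le> card V"
    using card DIM_positive[where 'a='a] by simp
  have ne: "V - {u} \<noteq> {}"
  proof
    assume "V - {u} = {}"
    then have "V = {u}"
      using u by blast
    then show False
      using card2 by simp
  qed
  show a0: "a \<noteq> 0"
    using ne eq gt by fastforce
  show facet: "?F facet_of ?S"
    using facet_of_convex_hull_affine_independent_alt[OF indep] card2 u by blast
  have dim: "aff_dim ?S = int DIM('a)"
    using aff_dim_affine_independent[OF indep] card by (simp add: aff_dim_convex_hull)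
  have "is_inward_unit_normal ?S ?F (a /\<^sub>R norm a)"
    unfolding is_inward_unit_normal_def
  proof (intro conjI exI[of _ "b / norm a"])
    show "?S \<subseteq> {x. b / norm a \<le> (a /\<^sub>R norm a) \<bullet> x}"
      using convex_hull_supporting_hyperplane_opposite(1)[OF u ne eq gt] a0
      by (auto simp: field_simps)
    show "?F = ?S \<inter> {x. (a /\<^sub>R norm a) \<bullet> x = b / norm a}"
      using convex_hull_supporting_hyperplane_opposite(2)[OF u ne eq gt] a0
      by (auto simp: field_simps)
  qed (use a0 in simp)
  then show "inward_unit_normal ?S ?F = a /\<^sub>R norm a"
    unfolding inward_unit_normal_def
    using inward_unit_normal_unique[OF dim facet] by blast
qed

text \<open>A dihedral angle of at most \<open>pi / 2\<close> puts the normals at an angle of at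
  least \<open>pi / 2\<close>, so their cosine is nonpositive. Positive scaling keeps the sign, so
  the normals need not be units.\<close>

lemma nonobtuse_simplex_inner_normals_nonpos:
  fixes a a' :: "'a::euclidean_space"
  assumes nonobt: "nonobtuse (convex hull V)"
    and indep: "\<not> affine_dependent V" and card: "card V = DIM('a) + 1"
    and u: "u \<in> V" and v: "v \<in> V" and "u \<noteq> v"
    and eq: "\<And>w. w \<in> V - {u} \<Longrightarrow> a \<bullet> w = b" and gt: "a \<bullet> u > b"
    and eq': "\<And>w. w \<in> V - {v} \<Longrightarrow> a' \<bullet> w = b'" and gt': "a' \<bullet> v > b'"
  shows "a \<bullet> a' \<le> 0"
proof -
  let ?S = "convex hull V" and ?F = "convex hull (V - {u})" and ?G = "convex hull (V - {v})"
  have N: "?F facet_of ?S" "inward_unit_normal ?S ?F = a /\<^sub>R norm a" "a \<noteq> 0"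
    using inward_unit_normal_simplex[OF indep card u eq gt] by auto
  have N': "?G facet_of ?S" "inward_unit_normal ?S ?G = a' /\<^sub>R norm a'" "a' \<noteq> 0"
    using inward_unit_normal_simplex[OF indep card v eq' gt'] by auto
  \<comment> \<open>\<open>nonobtuse\<close> constrains distinct facets only; the vertex
    \<open>u\<close> tells these two apart.\<close>
  have "u \<in> ?G"
    using u \<open>u \<noteq> v\<close> by (simp add: hull_inc)
  moreover have "?F \<subseteq> {x. a \<bullet> x = b}"
    using eq by (intro hull_minimal) (auto simp: convex_hyperplane)
  then have "u \<notin> ?F"
    using gt by auto
  ultimately have "?F \<noteq> ?G"
    by blast
  then have "dihedral_angle ?S ?F ?G \<le> pi / 2"
    using nonobt N(1) N'(1) unfolding nonobtuse_def by blast
  then have ge: "pi / 2 \<le> arccos ((a /\<^sub>R norm a) \<bullet> (a' /\<^sub>R norm a'))"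
    using N(3) N'(3) by (simp add: N(2) N'(2) dihedral_angle_def vector_angle_def)
  let ?c = "(a /\<^sub>R norm a) \<bullet> (a' /\<^sub>R norm a')"
  \<comment> \<open>Cauchy-Schwarz keeps \<open>?c\<close> in the range where \<open>cos\<close>
    undoes \<open>arccos\<close>.\<close>
  have "\<bar>?c\<bar> \<le> 1"
    using Cauchy_Schwarz_ineq2[of "a /\<^sub>R norm a" "a' /\<^sub>R norm a'"] N(3) N'(3) by simp
  then have "cos (arccos ?c) = ?c" and "arccos ?c \<le> pi"
    by (auto simp: cos_arccos_abs arccos_ubound)
  moreover have "cos (arccos ?c) \<le> cos (pi / 2)"
    using ge \<open>arccos ?c \<le> pi\<close> by (intro cos_monotone_0_pi_le) auto
  ultimately have "?c \<le> 0"
    by simp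
  then show ?thesis
    using N(3) N'(3) by (simp add: mult_le_0_iff divide_le_0_iff zero_le_mult_iff)
qed

text \<open>The columns span, and a spanning set of at most n vectors is a basis. As
  \<open>columns P\<close> is a set, this count also shows that no two columns coincide.\<close>

lemma invertible_columns_simplex:
  fixes P :: "real^'n^'n"
  assumes "invertible P"
  shows "\<not> affine_dependent (insert 0 (columns P))"
    and "card (insert 0 (columns P)) = DIM(real^'n) + 1"
proof -
  have span: "span (columns P) = UNIV"
    using assms matrix_right_invertible_span_columns[of P] by (auto simp: invertible_def span_vec_eq)
  have cols: "columns P = (\<lambda>j. column j P) ` UNIV"
    by (auto simp: columns_def)
  then have fin: "finite (columns P)"
    by simp
  have le: "card (columns P) \<le> DIM(real^'n)"
    unfolding cols using card_image_le[of UNIV "\<lambda>j. column j P"] by simp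
  then have ind: "independent (columns P)"
    using span fin by (intro card_le_dim_spanning[of _ UNIV]) auto
  have "card (columns P) = DIM(real^'n)"
    using ind span dim_eq_card_independent[OF ind] by (metis dim_UNIV dim_span)
  moreover have "0 \<notin> columns P"
    using ind dependent_zero by blast
  ultimately show "\<not> affine_dependent (insert 0 (columns P))"
    and "card (insert 0 (columns P)) = DIM(real^'n) + 1"
    using ind fin by (simp_all add: affine_dependent_iff_dependent)
qed

lemma nonobtuse_simplex_gram:
  fixes P Q :: "real^'n^'n"
  assumes "invertible P"
    and nonobt: "nonobtuse (convex hull (insert 0 (columns P)))"
    and Q: "transpose Q ** P = mat 1"
  shows "j \<noteq> k \<Longrightarrow> column j Q \<bullet> column k Q \<le> 0"
    and "column j Q \<bullet> (\<Sum>k\<in>UNIV. column k Q) \<ge> 0"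
proof -
  let ?V = "insert 0 (columns P)"
  note simplex = invertible_columns_simplex[OF \<open>invertible P\<close>]
  \<comment> \<open>Hence \<open>column j Q\<close> vanishes at every vertex except
    \<open>column j P\<close>, where it is 1.\<close>
  have dual: "column j Q \<bullet> column k P = (if j = k then 1 else 0)" for j k
    using arg_cong[OF Q, of "\<lambda>M. M $ j $ k"]
    by (simp add: matrix_matrix_mult_def transpose_def column_def inner_vec_def mat_def)
  have V: "w = 0 \<or> (\<exists>l. w = column l P)" if "w \<in> ?V" for w
    using that by (auto simp: columns_def)
  have inV: "column l P \<in> ?V" for l
    by (auto simp: columns_def)
  have nz: "column l P \<noteq> 0" for l
    using dual[of l l] by auto
  have eq: "column j Q \<bullet> w = 0" if "w \<in> ?V - {column j P}" for j w
    using that V[of w] dual[of j] by auto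
  have gt: "column j Q \<bullet> column j P > 0" for j
    by (simp add: dual)
  show "column j Q \<bullet> column k Q \<le> 0" if "j \<noteq> k"
  proof (rule nonobtuse_simplex_inner_normals_nonpos[OF nonobt simplex inV inV _ eq gt eq gt])
    show "column j P \<noteq> column k P"
      using dual[of j j] dual[of j k] that by auto
  qed
  \<comment> \<open>By duality \<open>?q\<close> takes the value -1 at every column of
    \<open>P\<close> and the larger value 0 at the origin.\<close>
  let ?q = "- (\<Sum>k\<in>UNIV. column k Q)"
  have "column j Q \<bullet> ?q \<le> 0"
  proof (rule nonobtuse_simplex_inner_normals_nonpos[OF nonobt simplex inV _ nz eq gt])
    show "?q \<bullet> w = - 1" if "w \<in> ?V - {0}" for w
      using that V[of w] by (auto simp: inner_sum_left dual)
  qed auto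
  then show "column j Q \<bullet> (\<Sum>k\<in>UNIV. column k Q) \<ge> 0"
    by simp
qed

theorem theorem3p5:
  fixes P Q C D :: "real^'n^'n"
  assumes "\<forall>i j. P $ i $ j \<in> {0, 1}"
    and "invertible P"
    and "nonobtuse (convex hull (insert 0 (columns P)))"
    and "Q = transpose (matrix_inv P)"
    and "C = (1/2) *\<^sub>R (\<bar>Q\<bar> - Q)"
    and "D = (1/2) *\<^sub>R (\<bar>Q\<bar> + Q)"
  shows "(\<forall>i j. (P $ i $ j = 1 \<longrightarrow> Q $ i $ j \<ge> 0) \<and> (P $ i $ j = 0 \<longrightarrow> Q $ i $ j \<le> 0))
    \<and> nonneg_matrix C \<and> nonneg_matrix D
    \<and> Q = D - C \<and> doubly_stochastic D \<and> row_substochastic C"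
proof -
  \<comment> \<open>\<open>matrix_inv\<close> is a Hilbert choice, and invertibility makes it a
    two-sided inverse.\<close>
  have QP: "transpose Q ** P = mat 1" and PQ: "P ** transpose Q = mat 1"
    using someI_ex[OF \<open>invertible P\<close>[unfolded invertible_def]] assms(4)
    by (simp_all add: matrix_inv_def)
  define G where "G j k = column j Q \<bullet> column k Q" for j k
  have G_off: "G k j \<le> 0" if "k \<noteq> j" for j k
    using nonobtuse_simplex_gram(1)[OF assms(2,3) QP that] by (simp add: G_def)
  have G_row: "(\<Sum>k\<in>UNIV. G j k) \<ge> 0" for j
    using nonobtuse_simplex_gram(2)[OF assms(2,3) QP, of j] by (simp add: G_def inner_sum_right)
  have G_sym: "G j k = G k j" for j k
    by (simp add: G_def inner_commute)
  have P01: "P $ i $ j = 0 \<or> P $ i $ j = 1" for i j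
    using assms(1) by blast
  have Q_eq: "Q $ i $ j = (\<Sum>k\<in>UNIV. P $ i $ k * G k j)" for i j
  proof -
    have "Q = P ** (transpose Q ** Q)"
      using PQ by (simp add: matrix_mul_assoc)
    then have "Q $ i $ j = (P ** (transpose Q ** Q)) $ i $ j"
      by simp
    then show ?thesis
      by (simp add: matrix_matrix_mult_def transpose_def G_def inner_vec_def column_def)
  qed
  have pos: "Q $ i $ j \<ge> 0" if "P $ i $ j = 1" for i j
  proof -
    \<comment> \<open>The diagonal term is kept in full; the others are nonpositive, so a factor 0
      or 1 cannot decrease them.\<close>
    have "P $ i $ k * G k j \<ge> G k j" for k
      using P01[of i k] G_off[of k j] that by (cases "k = j") auto
    then have "(\<Sum>k\<in>UNIV. G k j) \<le> Q $ i $ j"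
      unfolding Q_eq by (intro sum_mono)
    then show ?thesis
      using G_row[of j] G_sym[of j] by simp
  qed
  have neg: "Q $ i $ j \<le> 0" if "P $ i $ j = 0" for i j
  proof -
    \<comment> \<open>The diagonal entry \<open>G j j\<close>, the only one that could be positive,
      has coefficient 0 here.\<close>
    have "P $ i $ k * G k j \<le> 0" for k
      using P01[of i k] G_off[of k j] that by (cases "k = j") auto
    then show ?thesis
      unfolding Q_eq by (intro sum_nonpos)
  qed
  have Q_row: "(\<Sum>j\<in>UNIV. Q $ i $ j) \<ge> 0" for i
  proof -
    have "(\<Sum>j\<in>UNIV. Q $ i $ j) = (\<Sum>k\<in>UNIV. P $ i $ k * (\<Sum>j\<in>UNIV. G k j))"
      unfolding Q_eq sum_distrib_left by (rule sum.swap)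
    also have "\<dots> \<ge> 0"
    proof (intro sum_nonneg)
      show "P $ i $ k * (\<Sum>j\<in>UNIV. G k j) \<ge> 0" for k
        using P01[of i k] G_row[of k] by auto
    qed
    finally show ?thesis .
  qed
  \<comment> \<open>\<open>D\<close> is the positive part of \<open>Q\<close>, and by the sign
    pattern \<open>P\<close> selects it.\<close>
  have D_nth: "D $ i $ j = P $ i $ j * Q $ i $ j" for i j
    using P01[of i j] pos[of i j] neg[of i j] assms(6) by (auto simp: abs_matrix_nth)
  have C_nth: "C $ i $ j = D $ i $ j - Q $ i $ j" for i j
    unfolding assms(5,6) by (simp add: field_simps)
  have nonneg: "nonneg_matrix C" "nonneg_matrix D"
    using assms(5,6) by (auto simp: nonneg_matrix_def abs_matrix_nth)
  have Q_diff: "Q = D - C"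
    by (simp add: vec_eq_iff C_nth)
  have D_row: "(\<Sum>j\<in>UNIV. D $ i $ j) = 1" for i
    using arg_cong[OF PQ, of "\<lambda>M. M $ i $ i"]
    by (simp add: D_nth matrix_matrix_mult_def transpose_def mat_def)
  have D_col: "(\<Sum>i\<in>UNIV. D $ i $ j) = 1" for j
    using arg_cong[OF QP, of "\<lambda>M. M $ j $ j"]
    by (simp add: D_nth matrix_matrix_mult_def transpose_def mat_def mult.commute)
  \<comment> \<open>Each row sum of \<open>C\<close> is 1 minus the corresponding row sum of
    \<open>Q\<close>.\<close>
  have "(\<Sum>j\<in>UNIV. C $ i $ j) \<le> 1" for i
    using Q_row[of i] by (simp add: C_nth sum_subtractf D_row)
  then show ?thesis
    using pos neg nonneg Q_diff D_row D_col
    by (simp add: doubly_stochastic_def row_substochastic_def)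
qed

end
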